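(* Let $G$ be a connected finite $\delta$-hyperbolic graph. Every vertex $x$ of $G$ satisfies $d(x,C_{\le 2\delta}(G))+rad(G)+2\delta\ge e(x)\ge d(x,C_{\le 2\delta}(G))+rad(G)$ and $d(x,C(G))+rad(G)-4\delta\le e(x)\le d(x,C(G))+rad(G)$.
   Context: $G$ is $\delta$-hyperbolic if for any four vertices $u,v,w,x$ the two larger of $d(u,v)+d(w,x)$, $d(u,w)+d(v,x)$, $d(u,x)+d(v,w)$ differ by at most $2\delta$ ($d$ = shortest-path distance); $d(x,S)=\min_{u\in S}d(x,u)$. $e(v)=\max_u d(v,u)$, $rad(G)=\min_v e(v)$, $C_{\le k}(G)=\{v: e(v)\le rad(G)+k\}$, $C(G)=C_{\le 0}(G)$. *)

theory Defs
  imports "Graph_Theory.Graph_Theory"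
begin

definition gdist :: "('a, 'b) pre_digraph \<Rightarrow> 'a \<Rightarrow> 'a \<Rightarrow> nat" where
  "gdist G u v = (LEAST n. \<exists>p. pre_digraph.awalk G u p v \<and> length p = n)"

text \<open>Agreement with the library's shortest-path cost for unit arc weights.\<close>

lemma (in wf_digraph) gdist_eq_\<mu>:
  assumes "u \<rightarrow>\<^sup>* v"
  shows "\<mu> (\<lambda>_. 1) u v = ereal (real (gdist G u v))"
proof -
  let ?P = "\<lambda>n. \<exists>p. awalk u p v \<and> length p = n"
  have cost: "awalk_cost (\<lambda>_. 1) p = real (length p)" for p :: "'b list"
    by (induction p) auto
  have "\<exists>n. ?P n"
    using assms by (auto simp: reachable_awalk)
  then have "?P (gdist G u v)"
    unfolding gdist_def by (rule LeastI_ex)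
  then obtain p where p: "awalk u p v" "length p = gdist G u v"
    by blast
  have le: "gdist G u v \<le> length q" if "awalk u q v" for q
    unfolding gdist_def by (rule Least_le) (use that in blast)
  show ?thesis
  proof (rule antisym)
    show "\<mu> (\<lambda>_. 1) u v \<le> ereal (real (gdist G u v))"
      using min_cost_le_walk_cost[OF p(1), of "\<lambda>_. 1"] by (simp add: cost p(2))
    show "ereal (real (gdist G u v)) \<le> \<mu> (\<lambda>_. 1) u v"
      unfolding \<mu>_def by (rule INF_greatest) (simp add: cost le)
  qed
qed

definition gdist_set :: "('a, 'b) pre_digraph \<Rightarrow> 'a \<Rightarrow> 'a set \<Rightarrow> nat" where
  "gdist_set G x S = Min (gdist G x ` S)"

definition ecc :: "('a, 'b) pre_digraph \<Rightarrow> 'a \<Rightarrow> nat" where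
  "ecc G v = Max (gdist G v ` verts G)"

definition rad :: "('a, 'b) pre_digraph \<Rightarrow> nat" where
  "rad G = Min (ecc G ` verts G)"

definition center_upto :: "('a, 'b) pre_digraph \<Rightarrow> real \<Rightarrow> 'a set" where
  "center_upto G k = {v \<in> verts G. real (ecc G v) \<le> real (rad G) + k}"

definition center :: "('a, 'b) pre_digraph \<Rightarrow> 'a set" where
  "center G = center_upto G 0"

text \<open>
  Positions 2 and 1 of the ascending list hold the largest and second largest sum.
\<close>

definition hyperbolic :: "real \<Rightarrow> ('a, 'b) pre_digraph \<Rightarrow> bool" where
  "hyperbolic \<delta> G \<longleftrightarrow>
    (\<forall>u\<in>verts G. \<forall>v\<in>verts G. \<forall>w\<in>verts G. \<forall>x\<in>verts G.
      let s = sort [gdist G u v + gdist G w x,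
                    gdist G u w + gdist G v x,
                    gdist G u x + gdist G v w]
      in real (s ! 2) - real (s ! 1) \<le> 2 * \<delta>)"

end

theory Submission
  imports Defs
begin

text \<open>
  Both upper bounds are the triangle inequality. For the lower bound by
  \<open>C_{\<le>2\<delta>}\<close>, walk from \<open>x\<close> along a geodesic to a furthest vertex \<open>y\<close> and stop at
  distance \<open>rad\<close> from \<open>y\<close>: since \<open>d(x,u) \<le> d(x,y)\<close> and \<open>d(y,u) \<le> 2 rad\<close> for all \<open>u\<close>, the
  four-point condition puts that vertex in \<open>C_{\<le>2\<delta>}\<close>. For the lower bound by \<open>C\<close>, let \<open>c\<close> be
  a central vertex nearest to \<open>x\<close>, with \<open>d(x,c) > 2\<delta>\<close> (else trivial). The vertex \<open>z\<close> at distance \<open>\<lfloor>2\<delta>\<rfloor> + 1\<close> from \<open>c\<close> on a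
  geodesic to \<open>x\<close> is not central, so some \<open>y\<close> has \<open>d(z,y) > rad \<ge> d(c,y)\<close>. The
  four-point condition for \<open>x, c, z, y\<close> then forces \<open>d(x,y)\<close> to be large.
\<close>

section \<open>Metric properties of distance, and points on geodesics\<close>

locale connected_graph = graph G for G :: "('a, 'b) pre_digraph" (structure) +
  assumes connected: "Digraph_Component.connected G"
begin

lemma reachable_in_connected:
  assumes "u \<in> verts G" "v \<in> verts G"
  shows "u \<rightarrow>\<^sup>* v"
  using symmetric_connected_imp_strongly_connected[OF sym_arcs connected] assms
  by (auto elim: strongly_connectedE)

lemma gdist_walk:
  assumes "u \<in> verts G" "v \<in> verts G"
  obtains p where "awalk u p v" "length p = gdist G u v"
proof -
  have "\<exists>n p. awalk u p v \<and> length p = n"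
    using reachable_in_connected[OF assms] by (auto simp: reachable_awalk)
  then have "\<exists>p. awalk u p v \<and> length p = gdist G u v"
    unfolding gdist_def by (rule LeastI_ex)
  then show ?thesis using that by blast
qed

lemma gdist_le_length: "awalk u p v \<Longrightarrow> gdist G u v \<le> length p"
  unfolding gdist_def by (rule Least_le) blast

lemma gdist_triangle:
  assumes "u \<in> verts G" "v \<in> verts G" "w \<in> verts G"
  shows "gdist G u w \<le> gdist G u v + gdist G v w"
proof -
  obtain p where p: "awalk u p v" "length p = gdist G u v"
    using gdist_walk assms by blast
  obtain q where q: "awalk v q w" "length q = gdist G v w"
    using gdist_walk assms by blast
  show ?thesis
    using gdist_le_length[OF awalk_appendI[OF p(1) q(1)]] p q by simp
qed

text \<open>Replace each arc by its opposite, which exists because the arc set is symmetric. This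
  makes \<open>gdist\<close> symmetric.\<close>

lemma awalk_reverse:
  "awalk u p v \<Longrightarrow> \<exists>q. awalk v q u \<and> length q = length p"
proof (induction p arbitrary: u)
  case Nil
  then show ?case by (auto simp: awalk_Nil_iff)
next
  case (Cons e p)
  then obtain q where q: "awalk v q (head G e)" "length q = length p"
    by (auto simp: awalk_Cons_iff)
  from Cons.prems have e: "e \<in> arcs G" "u = tail G e" by (auto simp: awalk_Cons_iff)
  then obtain e' where e': "e' \<in> arcs G" "tail G e = head G e'" "head G e = tail G e'"
    using sym_arcs unfolding symmetric_conv by blast
  then have "awalk (head G e) [e'] u"
    using e by (simp add: awalk_simps)
  then have "awalk v (q @ [e']) u" using q(1) by (rule awalk_appendI[rotated])
  then show ?case using q(2) by (intro exI[of _ "q @ [e']"]) simp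
qed

lemma gdist_commute:
  assumes "u \<in> verts G" "v \<in> verts G"
  shows "gdist G u v = gdist G v u"
proof -
  have "gdist G b a \<le> gdist G a b" if ab: "a \<in> verts G" "b \<in> verts G" for a b
  proof -
    obtain p where "awalk a p b" "length p = gdist G a b"
      using gdist_walk ab by blast
    then show ?thesis using awalk_reverse gdist_le_length by metis
  qed
  then show ?thesis using assms by (simp add: antisym)
qed

text \<open>Cut a shortest walk after \<open>k\<close> arcs. The two pieces bound the distances from
  above, and the triangle inequality forces equality in both.\<close>

lemma geodesic_point:
  assumes "u \<in> verts G" "v \<in> verts G" "k \<le> gdist G u v"
  obtains w where "w \<in> verts G" "gdist G u w = k" "gdist G w v = gdist G u v - k"
proof -
  obtain p where p: "awalk u p v" "length p = gdist G u v"
    using gdist_walk assms by blast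
  let ?w = "awlast u (take k p)"
  have w: "awalk u (take k p) ?w" "awalk ?w (drop k p) v"
    using p(1) awalk_append_iff[of u "take k p" "drop k p" v] by simp_all
  then have wv: "?w \<in> verts G" by auto
  have "gdist G u ?w \<le> k" "gdist G ?w v \<le> gdist G u v - k"
    using gdist_le_length[OF w(1)] gdist_le_length[OF w(2)] p(2) by simp_all
  with gdist_triangle[OF assms(1) wv assms(2)] assms(3) show ?thesis
    by (intro that[OF wv]) auto
qed

section \<open>Eccentricity, radius and center; the upper bounds\<close>

lemma gdist_le_ecc: "u \<in> verts G \<Longrightarrow> gdist G v u \<le> ecc G v"
  unfolding ecc_def by (rule Max_ge) auto

lemma ecc_attained:
  assumes "v \<in> verts G"
  obtains u where "u \<in> verts G" "gdist G v u = ecc G v"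
proof -
  have "ecc G v \<in> gdist G v ` verts G"
    unfolding ecc_def by (rule Max_in) (use assms in auto)
  then show ?thesis using that by auto
qed

lemma rad_le_ecc: "v \<in> verts G \<Longrightarrow> rad G \<le> ecc G v"
  unfolding rad_def by (rule Min_le) auto

lemma center_nonempty:
  assumes "verts G \<noteq> {}"
  shows "center G \<noteq> {}"
proof -
  have "rad G \<in> ecc G ` verts G"
    unfolding rad_def by (rule Min_in) (use assms in auto)
  then show ?thesis unfolding center_def center_upto_def by auto
qed

lemma center_iff: "v \<in> center G \<longleftrightarrow> v \<in> verts G \<and> ecc G v = rad G"
  using rad_le_ecc by (auto simp: center_def center_upto_def intro: antisym)

text \<open>Pass through a central vertex, which is within \<open>rad G\<close> of both
  ends.\<close>

lemma gdist_le_2_rad: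
  assumes "u \<in> verts G" "v \<in> verts G"
  shows "gdist G u v \<le> 2 * rad G"
proof -
  obtain c where c: "c \<in> verts G" "ecc G c = rad G"
    using center_nonempty assms center_iff by blast
  show ?thesis
    using gdist_triangle[OF assms(1) c(1) assms(2)] gdist_commute[OF assms(1) c(1)]
      gdist_le_ecc[OF assms(1), of c] gdist_le_ecc[OF assms(2), of c] c(2) by simp
qed

lemma ecc_le_gdist_add_ecc:
  assumes "x \<in> verts G" "c \<in> verts G"
  shows "ecc G x \<le> gdist G x c + ecc G c"
proof -
  obtain y where y: "y \<in> verts G" "gdist G x y = ecc G x"
    using ecc_attained assms by blast
  show ?thesis
    using gdist_triangle[OF assms y(1)] gdist_le_ecc[OF y(1), of c] y(2) by simp
qed

lemma gdist_set_le:
  assumes "S \<subseteq> verts G" "c \<in> S"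
  shows "gdist_set G x S \<le> gdist G x c"
  unfolding gdist_set_def
  by (rule Min_le) (use assms finite_subset[OF _ finite_verts] in auto)

lemma gdist_set_attained:
  assumes "S \<subseteq> verts G" "S \<noteq> {}"
  obtains c where "c \<in> S" "gdist_set G x S = gdist G x c"
proof -
  have "gdist_set G x S \<in> gdist G x ` S"
    unfolding gdist_set_def
    by (rule Min_in) (use assms finite_subset[OF _ finite_verts] in auto)
  then show ?thesis using that by auto
qed

lemma center_upto_subset: "center_upto G k \<subseteq> verts G"
  by (auto simp: center_upto_def)

lemma center_subset_center_upto: "0 \<le> k \<Longrightarrow> center G \<subseteq> center_upto G k"
  by (auto simp: center_def center_upto_def)

text \<open>Serves both upper bounds, with \<open>k\<close> equal to 2\<delta> and to 0. For
  \<open>k\<close> \<ge> 0 the set contains the nonempty center, so the minimum over it is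
  attained.\<close>

lemma ecc_le_gdist_set_center_upto:
  assumes "x \<in> verts G" "0 \<le> k"
  shows "real (ecc G x) \<le> real (gdist_set G x (center_upto G k)) + real (rad G) + k"
proof -
  have "center_upto G k \<noteq> {}"
    using center_nonempty center_subset_center_upto assms by blast
  then obtain c where c: "c \<in> center_upto G k"
      "gdist_set G x (center_upto G k) = gdist G x c"
    using gdist_set_attained center_upto_subset by metis
  then have "c \<in> verts G" "real (ecc G c) \<le> real (rad G) + k"
    by (auto simp: center_upto_def)
  then show ?thesis
    using ecc_le_gdist_add_ecc[OF assms(1), of c] c(2) by simp
qed

end

section \<open>The four-point condition as an inequality\<close>

lemma hyperbolic_four_point:
  assumes "hyperbolic \<delta> G"
    and "u \<in> verts G" "v \<in> verts G" "w \<in> verts G" "x \<in> verts G"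
  shows "real (gdist G u v) + real (gdist G w x)
    \<le> max (real (gdist G u w) + real (gdist G v x))
          (real (gdist G u x) + real (gdist G v w)) + 2 * \<delta>"
proof -
  \<comment> \<open>If \<open>a\<close> is the largest sum, then \<open>s ! 1\<close> is the maximum
    of \<open>b\<close> and \<open>c\<close>. Otherwise \<open>a\<close> is at most that maximum,
    and \<delta> \<ge> 0 because \<open>s\<close> is ascending.\<close>
  have *: "real (s ! 2) - real (s ! 1) \<le> 2 * \<delta> \<Longrightarrow>
      s = sort [a, b, c] \<Longrightarrow> real a \<le> max (real b) (real c) + 2 * \<delta>"
    for s :: "nat list" and a b c
    by (auto simp: max_def split: if_splits)
  show ?thesis
    using assms unfolding hyperbolic_def Let_def
    by (metis (no_types, lifting) * of_nat_add)
qed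

text \<open>For four equal vertices the three sums coincide and cancel.\<close>

lemma hyperbolic_nonneg:
  assumes "hyperbolic \<delta> G" "x \<in> verts G"
  shows "0 \<le> \<delta>"
  using hyperbolic_four_point[OF assms(1), of x x x x] assms(2) by simp

section \<open>The two lower bounds\<close>

context connected_graph
begin

lemma gdist_set_center_upto_le_ecc:
  assumes hyp: "hyperbolic \<delta> G" and x: "x \<in> verts G"
  shows "gdist_set G x (center_upto G (2 * \<delta>)) + rad G \<le> ecc G x"
proof -
  obtain y where y: "y \<in> verts G" "gdist G x y = ecc G x"
    using ecc_attained x by blast
  have r: "rad G \<le> ecc G x" using rad_le_ecc x by blast
  obtain c where c: "c \<in> verts G" "gdist G x c = ecc G x - rad G" "gdist G c y = rad G"
    using geodesic_point[OF x y(1), of "ecc G x - rad G"] y(2) r by auto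
  obtain u where u: "u \<in> verts G" "gdist G c u = ecc G c"
    using ecc_attained c by blast
  \<comment> \<open>The left side is \<open>ecc G x + ecc G c\<close>. Both sums under the maximum
    are at most \<open>ecc G x + rad G\<close>: the first by
    \<open>(ecc G x - rad G) + 2 * rad G\<close>, the second directly. Cancelling
    \<open>ecc G x\<close> bounds \<open>ecc G c\<close>.\<close>
  have "real (gdist G x y) + real (gdist G c u)
      \<le> max (real (gdist G x c) + real (gdist G y u))
            (real (gdist G x u) + real (gdist G y c)) + 2 * \<delta>"
    by (rule hyperbolic_four_point[OF hyp x y(1) c(1) u(1)])
  then have "real (ecc G c) \<le> real (rad G) + 2 * \<delta>"
    using gdist_le_2_rad[OF y(1) u(1)] gdist_le_ecc[OF u(1), of x]
      gdist_commute[OF y(1) c(1)] y(2) c u(2) r by (auto simp: max_def split: if_splits)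
  then have "c \<in> center_upto G (2 * \<delta>)" using c(1) by (simp add: center_upto_def)
  then show ?thesis
    using gdist_set_le[OF center_upto_subset, of c "2 * \<delta>" x] c(2) r by simp
qed

lemma gdist_set_center_le_ecc:
  assumes hyp: "hyperbolic \<delta> G" and x: "x \<in> verts G"
  shows "real (gdist_set G x (center G)) + real (rad G) - 4 * \<delta> \<le> real (ecc G x)"
proof -
  have \<delta>: "0 \<le> \<delta>" using hyperbolic_nonneg hyp x .
  have sub: "center G \<subseteq> verts G" using center_iff by blast
  have "center G \<noteq> {}" using center_nonempty x by blast
  then obtain c where c: "c \<in> center G" "gdist_set G x (center G) = gdist G x c"
    using gdist_set_attained[OF sub] by blast
  then have cv: "c \<in> verts G" "ecc G c = rad G" by (auto simp: center_iff)
  \<comment> \<open>The least integer strictly above 2\<delta>: strictness rules out one branch of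
    the four-point maximum, while \<open>t\<close> \<le> 2\<delta> + 1 limits the final
    loss.\<close>
  define t where "t = nat \<lfloor>2 * \<delta>\<rfloor> + 1"
  have t: "2 * \<delta> < real t" "real t \<le> 2 * \<delta> + 1" unfolding t_def using \<delta> by linarith+
  show ?thesis
  proof (cases "t \<le> gdist G x c")
    case False
    then have "real (gdist G x c) \<le> 2 * \<delta>" using t by linarith
    then show ?thesis using rad_le_ecc[OF x] c(2) \<delta> by simp
  next
    case True
    then obtain z where z: "z \<in> verts G" "gdist G x z = gdist G x c - t" "gdist G z c = t"
      using geodesic_point[OF x cv(1), of "gdist G x c - t"] by auto
    have "gdist G x z < gdist G x c" using z(2) True t_def by simp
    then have "z \<notin> center G" using gdist_set_le[OF sub, of z x] c(2) by linarith
    then have ez: "rad G < ecc G z" using z(1) rad_le_ecc[OF z(1)] center_iff by force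
    obtain y where y: "y \<in> verts G" "gdist G z y = ecc G z"
      using ecc_attained z by blast
    have "real (gdist G x c) + real (gdist G z y)
        \<le> max (real (gdist G x z) + real (gdist G c y))
              (real (gdist G x y) + real (gdist G c z)) + 2 * \<delta>"
      by (rule hyperbolic_four_point[OF hyp x cv(1) z(1) y(1)])
    moreover have "real (gdist G x z) = real (gdist G x c) - real t"
      using z(2) True by simp
    moreover have "gdist G c y \<le> rad G" using gdist_le_ecc[OF y(1), of c] cv(2) by simp
    \<comment> \<open>The branch through \<open>gdist G x z + gdist G c y\<close> would give
      \<open>gdist G z y\<close> \<le> \<open>rad G\<close> - \<open>t\<close> + 2\<delta> <
      \<open>rad G\<close>, contradicting \<open>ez\<close>.\<close>
    ultimately have "real (gdist G x c) + real (gdist G z y)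
        \<le> real (gdist G x y) + real (gdist G c z) + 2 * \<delta>"
      using t y(2) ez by (auto simp: max_def split: if_splits)
    moreover have "gdist G c z = t" using gdist_commute[OF cv(1) z(1)] z(3) by simp
    \<comment> \<open>The loss \<open>t\<close> + 2\<delta> is at most 4\<delta> + 1; the extra 1 is
      recovered from \<open>ecc G z\<close> \<ge> \<open>rad G\<close> + 1, as eccentricities are
      integers.\<close>
    ultimately show ?thesis
      using t y(2) ez c(2) gdist_le_ecc[OF y(1), of x] by linarith
  qed
qed

end

theorem theorem25:
  fixes G :: "('a, 'b) pre_digraph" and \<delta> :: real and x :: 'a
  assumes "graph G"
    and "Digraph_Component.connected G"
    and "hyperbolic \<delta> G"
    and "x \<in> verts G"
  shows "real (gdist_set G x (center_upto G (2 * \<delta>))) + real (rad G) + 2 * \<delta> \<ge> real (ecc G x)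
    \<and> real (ecc G x) \<ge> real (gdist_set G x (center_upto G (2 * \<delta>))) + real (rad G)
    \<and> real (gdist_set G x (center G)) + real (rad G) - 4 * \<delta> \<le> real (ecc G x)
    \<and> real (ecc G x) \<le> real (gdist_set G x (center G)) + real (rad G)"
proof -
  interpret graph G by fact
  interpret connected_graph G by unfold_locales fact
  have "0 \<le> 2 * \<delta>" using hyperbolic_nonneg assms(3,4) by simp
  then show ?thesis
    using ecc_le_gdist_set_center_upto[OF assms(4), of "2 * \<delta>"]
      ecc_le_gdist_set_center_upto[OF assms(4), of 0]
      gdist_set_center_upto_le_ecc[OF assms(3,4)] gdist_set_center_le_ecc[OF assms(3,4)]
    by (simp add: center_def)
qed

end
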